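(* The following (indefinite) integral representation holds for the generalized hypergeometric-Mittag-Leffler functions ${}_{{}_pF_q}E_{(\alpha,\beta)}(a_1,\dots,a_p;b_1,\dots,b_q;u)$, with $\alpha,\beta\in\mathbb{R}^{+}$: $$\int u^{\delta}\;{}_{{}_pF_q}E_{(\alpha,\beta)}(a_1,\dots,a_p;b_1,\dots,b_q;u)\,du=\frac{u^{\delta+1}}{\delta+1}\;{}_{{}_{p+1}F_{q+1}}E_{(\alpha,\beta)}(a_1,\dots,a_p,\delta+1;\,b_1,\dots,b_q,\delta+2;\,u).$$
   Context: $(a)_r=\Gamma(a+r)/\Gamma(a)$ is the Pochhammer symbol. The generalized hypergeometric-Mittag-Leffler functions are given by $${}_{{}_pF_q}E_{(\alpha,\beta)}(a_1,\dots,a_p;b_1,\dots,b_q;u)=\sum_{r=0}^{\infty}\frac{(a_1)_r\cdots(a_p)_r}{(b_1)_r\cdots(b_q)_r}\,\frac{u^r}{\Gamma(\alpha r+\beta)} .$$ *)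

theory Defs
  imports "HOL-Analysis.Analysis"
begin

text \<open>
  The parameter tuples are lists, so that \<open>p\<close> and \<open>q\<close> are their lengths.
  The library's \<^const>\<open>pochhammer\<close> agrees with \<open>\<Gamma>(a + r) / \<Gamma>(a)\<close> whenever the latter is defined
  (\<open>pochhammer_Gamma\<close>), and is the usual finite product when \<open>a\<close> is a nonpositive integer.
\<close>

definition hml_coeff :: "real \<Rightarrow> real \<Rightarrow> complex list \<Rightarrow> complex list \<Rightarrow> nat \<Rightarrow> complex" where
  "hml_coeff \<alpha> \<beta> a b r =
     (\<Prod>x\<leftarrow>a. pochhammer x r) / (\<Prod>y\<leftarrow>b. pochhammer y r) / of_real (Gamma (\<alpha> * real r + \<beta>))"

definition hyp_mittag_leffler ::
    "real \<Rightarrow> real \<Rightarrow> complex list \<Rightarrow> complex list \<Rightarrow> complex \<Rightarrow> complex" where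
  "hyp_mittag_leffler \<alpha> \<beta> a b u = (\<Sum>r. hml_coeff \<alpha> \<beta> a b r * u ^ r)"

text \<open>
  The open disc of convergence of the series. It is the whole plane if \<open>p < q + \<alpha>\<close>, has positive
  finite radius if \<open>p = q + \<alpha>\<close>, and is empty if \<open>p > q + \<alpha>\<close>, except that it is the whole plane
  as soon as some \<open>a\<^sub>i\<close> is a nonpositive integer.
\<close>

definition hml_disc :: "real \<Rightarrow> real \<Rightarrow> complex list \<Rightarrow> complex list \<Rightarrow> complex set" where
  "hml_disc \<alpha> \<beta> a b = eball 0 (conv_radius (hml_coeff \<alpha> \<beta> a b))"

end

theory Submission
  imports Defs
begin

text \<open>
  Appending \<open>\<delta> + 1\<close> to the numerator and \<open>\<delta> + 2\<close> to the denominator parameters multiplies the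
  \<open>r\<close>-th coefficient by \<open>(\<delta> + 1) / (\<delta> + 1 + r)\<close>. This factor is bounded, so the disc of
  convergence does not shrink, and the new series \<open>G\<close> satisfies
  \<open>(\<delta> + 1) G + u G' = (\<delta> + 1) F\<close> there, where \<open>F\<close> is the original one. Multiplying by
  \<open>u\<^sup>\<delta> / (\<delta> + 1)\<close> gives the claim.
\<close>

text \<open>At every positive real \<open>s\<close> below the radius of \<open>c\<close> the power
  series converges absolutely, so a bound \<open>K\<close> on \<open>k\<close> turns it into a
  convergent majorant.\<close>

lemma conv_radius_mult_Bseq:
  fixes c k :: "nat \<Rightarrow> 'a :: {banach, real_normed_div_algebra}"
  assumes "Bseq k"
  shows "conv_radius c \<le> conv_radius (\<lambda>r. c r * k r)"
proof (rule conv_radius_geI_ex')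
  fix s :: real
  assume s: "0 < s" "ereal s < conv_radius c"
  obtain K where K: "\<And>r. norm (k r) \<le> K"
    using assms unfolding Bseq_def by blast
  have "summable (\<lambda>r. norm (c r * of_real s ^ r))"
    using s by (intro abs_summable_in_conv_radius) simp
  then have "summable (\<lambda>r. norm (c r * of_real s ^ r) * K)"
    by (rule summable_mult2)
  then show "summable (\<lambda>r. c r * k r * of_real s ^ r)"
  proof (rule summable_comparison_test')
    fix r
    show "norm (c r * k r * of_real s ^ r) \<le> norm (c r * of_real s ^ r) * K"
      using mult_left_mono[OF K[of r], of "norm (c r * of_real s ^ r)"]
      by (simp add: norm_mult mult_ac)
  qed
qed

text \<open>The quotient tends to \<open>0\<close>; a vanishing denominator can occur for at most
  one \<open>r\<close> and merely gives the term \<open>0\<close>.\<close>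

lemma Bseq_divide_add_of_nat:
  fixes d :: complex
  shows "Bseq (\<lambda>r. d / (d + of_nat r))"
proof -
  have "filterlim (\<lambda>r. d + of_nat r :: complex) at_infinity sequentially"
    by (rule tendsto_add_filterlim_at_infinity[OF tendsto_const tendsto_of_nat])
  then have "(\<lambda>r. d / (d + of_nat r)) \<longlonglongrightarrow> 0"
    by (intro tendsto_divide_0[OF tendsto_const])
  then show ?thesis
    by (intro convergent_imp_Bseq convergentI)
qed

text \<open>The first hypothesis settles \<open>r = 0\<close>, the second every
  \<open>r = Suc m\<close>; together they say that \<open>d\<close> is not a nonpositive
  integer.\<close>

lemma add_of_nat_nonzero:
  fixes d :: "'a :: ring_char_0"
  assumes "d \<noteq> 0" "d + 1 \<notin> \<int>\<^sub>\<le>\<^sub>0"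
  shows "d + of_nat r \<noteq> 0"
proof (cases r)
  case (Suc m)
  have "d + 1 \<noteq> - of_nat m"
    using assms(2) by auto
  then show ?thesis
    by (auto simp: Suc eq_neg_iff_add_eq_0 add_ac)
qed (use assms(1) in auto)

lemma pochhammer_shift_quotient:
  fixes d :: "'a :: field_char_0"
  assumes "d \<noteq> 0" "d + 1 \<notin> \<int>\<^sub>\<le>\<^sub>0"
  shows "pochhammer d r / pochhammer (d + 1) r = d / (d + of_nat r)"
proof -
  have "pochhammer (d + 1) r \<noteq> 0"
    using assms(2) by (auto simp: pochhammer_eq_0_iff)
  \<comment> \<open>Both sides are \<open>pochhammer d (Suc r)\<close>, with the last factor split
    off on the left and the first on the right.\<close>
  moreover have "pochhammer d r * (d + of_nat r) = d * pochhammer (d + 1) r"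
    by (metis pochhammer_Suc pochhammer_rec)
  ultimately show ?thesis
    using add_of_nat_nonzero[OF assms] by (simp add: frac_eq_eq)
qed

lemma hml_coeff_append_shift:
  assumes "d \<noteq> 0" "d + 1 \<notin> \<int>\<^sub>\<le>\<^sub>0"
  shows "hml_coeff \<alpha> \<beta> (a @ [d]) (b @ [d + 1]) r = hml_coeff \<alpha> \<beta> a b r * (d / (d + of_nat r))"
  unfolding hml_coeff_def pochhammer_shift_quotient[OF assms, symmetric] by simp

text \<open>Compare coefficients: \<open>u * G'\<close> multiplies the \<open>r\<close>-th
  coefficient of the new series by \<open>r\<close>, so the left side has coefficients
  \<open>(d + of_nat r) * ?g r\<close>, and the added factor cancels down to
  \<open>d * ?c r\<close>.\<close>

lemma hyp_mittag_leffler_append_shift_deriv: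
  assumes d: "d \<noteq> 0" "d + 1 \<notin> \<int>\<^sub>\<le>\<^sub>0" and u: "u \<in> hml_disc \<alpha> \<beta> a b"
  obtains G' where
    "(hyp_mittag_leffler \<alpha> \<beta> (a @ [d]) (b @ [d + 1]) has_field_derivative G') (at u)"
    "d * hyp_mittag_leffler \<alpha> \<beta> (a @ [d]) (b @ [d + 1]) u + u * G'
       = d * hyp_mittag_leffler \<alpha> \<beta> a b u"
proof -
  let ?c = "hml_coeff \<alpha> \<beta> a b" and ?g = "hml_coeff \<alpha> \<beta> (a @ [d]) (b @ [d + 1])"
  define G' where "G' = (\<Sum>r. diffs ?g r * u ^ r)"
  have g: "?g = (\<lambda>r. ?c r * (d / (d + of_nat r)))"
    using d by (intro ext hml_coeff_append_shift)
  have uc: "ereal (norm u) < conv_radius ?c"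
    using u by (simp add: hml_disc_def in_eball_iff)
  also have "\<dots> \<le> conv_radius ?g"
    unfolding g by (intro conv_radius_mult_Bseq Bseq_divide_add_of_nat)
  finally have ug: "ereal (norm u) < conv_radius ?g" .
  \<comment> \<open>Termwise differentiation at \<open>u\<close> requires convergence on a whole
    disc around \<open>0\<close> containing \<open>u\<close>, hence an intermediate radius.\<close>
  obtain R where R: "norm u < R" "ereal R < conv_radius ?g"
    using ereal_dense2[OF ug] by auto
  have sumg: "summable (\<lambda>r. ?g r * z ^ r)" if "norm z < R" for z
    using that R(2) by (intro summable_in_conv_radius) (meson ereal_less_eq(3) le_less_trans less_imp_le)
  have "(hyp_mittag_leffler \<alpha> \<beta> (a @ [d]) (b @ [d + 1]) has_field_derivative G') (at u)"
    unfolding hyp_mittag_leffler_def[abs_def] G'_def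
    using sumg R(1) by (intro termdiffs_strong') auto
  moreover have "d * hyp_mittag_leffler \<alpha> \<beta> (a @ [d]) (b @ [d + 1]) u + u * G'
       = d * hyp_mittag_leffler \<alpha> \<beta> a b u"
  proof -
    have "summable (\<lambda>r. diffs ?g r * u ^ r)"
      using sumg R(1) by (intro termdiff_converges) auto
    then have "(\<lambda>r. of_nat r * ?g r * u ^ (r - Suc 0)) sums G'"
      unfolding G'_def by (rule diffs_equiv)
    then have "(\<lambda>r. u * (of_nat r * ?g r * u ^ (r - Suc 0))) sums (u * G')"
      by (rule sums_mult)
    moreover have "(\<lambda>r. d * (?g r * u ^ r)) sums
        (d * hyp_mittag_leffler \<alpha> \<beta> (a @ [d]) (b @ [d + 1]) u)"
      unfolding hyp_mittag_leffler_def
      using sumg R(1) by (intro sums_mult summable_sums)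
    ultimately have "(\<lambda>r. d * (?g r * u ^ r) + u * (of_nat r * ?g r * u ^ (r - Suc 0))) sums
        (d * hyp_mittag_leffler \<alpha> \<beta> (a @ [d]) (b @ [d + 1]) u + u * G')"
      by (intro sums_add)
    moreover have "d * (?g r * u ^ r) + u * (of_nat r * ?g r * u ^ (r - Suc 0)) = d * (?c r * u ^ r)"
      for r
    proof -
      have "d * (?g r * u ^ r) + u * (of_nat r * ?g r * u ^ (r - Suc 0))
          = (d + of_nat r) * ?g r * u ^ r"
        \<comment> \<open>At \<open>r = 0\<close> the exponent \<open>r - Suc 0\<close> truncates to
          \<open>0\<close>, but the factor \<open>of_nat r\<close> removes that term.\<close>
        by (cases r) (simp_all add: algebra_simps)
      also have "(d + of_nat r) * ?g r = d * ?c r"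
        using add_of_nat_nonzero[OF d, of r] unfolding g by simp
      finally show ?thesis by simp
    qed
    moreover have "(\<lambda>r. d * (?c r * u ^ r)) sums (d * hyp_mittag_leffler \<alpha> \<beta> a b u)"
      unfolding hyp_mittag_leffler_def
      using uc by (intro sums_mult summable_sums summable_in_conv_radius)
    ultimately show ?thesis
      using sums_unique2 by simp
  qed
  ultimately show thesis
    by (rule that)
qed

theorem theorem6:
  fixes \<alpha> \<beta> :: real and a b :: "complex list" and \<delta> :: complex
  assumes "\<alpha> > 0" and "\<beta> > 0"
    and "\<forall>y\<in>set b. y \<notin> \<int>\<^sub>\<le>\<^sub>0"
    and "\<delta> + 1 \<noteq> 0" and "\<delta> + 2 \<notin> \<int>\<^sub>\<le>\<^sub>0"
  shows
    "(\<forall>u \<in> hml_disc \<alpha> \<beta> a b - \<real>\<^sub>\<le>\<^sub>0.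
        ((\<lambda>u. u powr (\<delta> + 1) / (\<delta> + 1) * hyp_mittag_leffler \<alpha> \<beta> (a @ [\<delta> + 1]) (b @ [\<delta> + 2]) u)
          has_field_derivative u powr \<delta> * hyp_mittag_leffler \<alpha> \<beta> a b u) (at u)) \<and>
     (\<forall>n::nat. \<delta> = of_nat n \<longrightarrow>
        (\<forall>u \<in> hml_disc \<alpha> \<beta> a b.
          ((\<lambda>u. u ^ (n + 1) / (\<delta> + 1) * hyp_mittag_leffler \<alpha> \<beta> (a @ [\<delta> + 1]) (b @ [\<delta> + 2]) u)
            has_field_derivative u ^ n * hyp_mittag_leffler \<alpha> \<beta> a b u) (at u)))"
proof -
  let ?F = "hyp_mittag_leffler \<alpha> \<beta> a b"
  let ?G = "hyp_mittag_leffler \<alpha> \<beta> (a @ [\<delta> + 1]) (b @ [\<delta> + 2])"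
  \<comment> \<open>Here \<open>P\<close> stands for the power with exponent
    \<open>\<delta> + 1\<close> and \<open>p\<close> for the value at \<open>u\<close> of the power
    with exponent \<open>\<delta>\<close>, so that principal and natural powers are treated at
    once.\<close>
  have antideriv: "((\<lambda>u. P u / (\<delta> + 1) * ?G u) has_field_derivative p * ?F u) (at u)"
    if u: "u \<in> hml_disc \<alpha> \<beta> a b" and P: "(P has_field_derivative (\<delta> + 1) * p) (at u)"
      and Pu: "P u = p * u" for P p u
  proof -
    have eq: "\<delta> + 1 + 1 = \<delta> + 2"
      by simp
    obtain G' where G': "(?G has_field_derivative G') (at u)"
      and ode: "(\<delta> + 1) * ?G u + u * G' = (\<delta> + 1) * ?F u"
      using hyp_mittag_leffler_append_shift_deriv[of "\<delta> + 1" u \<alpha> \<beta> a b] assms(4,5) u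
      unfolding eq by metis
    have "((\<lambda>u. P u / (\<delta> + 1) * ?G u) has_field_derivative
        P u / (\<delta> + 1) * G' + (\<delta> + 1) * p / (\<delta> + 1) * ?G u) (at u)"
      by (intro DERIV_mult' DERIV_cdivide P G')
    also have "P u / (\<delta> + 1) * G' + (\<delta> + 1) * p / (\<delta> + 1) * ?G u
        = p * ((\<delta> + 1) * ?G u + u * G') / (\<delta> + 1)"
      using assms(4) by (simp add: Pu add_divide_distrib algebra_simps)
    also have "\<dots> = p * ?F u"
      using assms(4) by (simp add: ode)
    finally show ?thesis .
  qed
  show ?thesis
  proof (intro conjI ballI allI impI)
    fix u assume u: "u \<in> hml_disc \<alpha> \<beta> a b - \<real>\<^sub>\<le>\<^sub>0"
    then have "u \<noteq> 0"
      by auto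
    then have "u powr (\<delta> + 1) = u powr \<delta> * u"
      by (simp add: powr_add)
    \<comment> \<open>The principal power is differentiable because \<open>u\<close> lies off its
      branch cut.\<close>
    moreover have "((\<lambda>u. u powr (\<delta> + 1)) has_field_derivative (\<delta> + 1) * u powr \<delta>) (at u)"
      using has_field_derivative_powr[of u "\<delta> + 1"] u by simp
    ultimately show "((\<lambda>u. u powr (\<delta> + 1) / (\<delta> + 1) * ?G u)
        has_field_derivative u powr \<delta> * ?F u) (at u)"
      using u by (intro antideriv) auto
  next
    fix n :: nat and u :: complex
    assume n: "\<delta> = of_nat n" and u: "u \<in> hml_disc \<alpha> \<beta> a b"
    \<comment> \<open>A natural power has no branch cut, so the whole disc is covered, including
      \<open>0\<close>.\<close>
    have "((\<lambda>u. u ^ (n + 1)) has_field_derivative (\<delta> + 1) * u ^ n) (at u)"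
      using DERIV_power_Suc[OF DERIV_ident, of n u] by (simp add: n add.commute)
    then show "((\<lambda>u. u ^ (n + 1) / (\<delta> + 1) * ?G u) has_field_derivative u ^ n * ?F u) (at u)"
      using u by (intro antideriv) auto
  qed
qed

end
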